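(* Let $G=A\rtimes \langle t\rangle$ be non-abelian, with $A$ finite abelian and $|t|=\omega$. For each divisor $n\mid\omega$ let $B_n:=\langle t^{\omega/n}\rangle$ and $C_n:=\mathrm{C}_A(B_n)$. Then for every integer $m\ge 2$, \[ c_m(G)=\sum_{\substack{n\mid \omega,\ d\mid n\\ m=|A:C_n|\,\omega d/n}}\mu(d)\,|A:C_n|. \] Equivalently, if $m_{n,d}:=|A:C_n|\,\omega d/n$, then \[ \mathcal P_G(z)=\sum_{n\mid \omega}\sum_{d\mid n} \frac{\mu(d)\,|A:C_n|}{m_{n,d}(m_{n,d}-z)}. \]
   Context: $A$ is the normal factor of the semidirect product, $\langle t\rangle$ is cyclic of order $\omega$ acting on $A$ by automorphisms, and $\mathrm{C}_A(B)$ is the subgroup of elements of $A$ fixed by every element of $B\le\langle t\rangle$. $\mu(d)$ is the number-theoretic Möbius function. For a finite group $G$ and $r\ge1$, $P_r(G):=|\mathrm{Hom}(\mathbb Z^r,G)|/|G|^r$, where $\mathrm{Hom}(\mathbb Z^r,G)$ is the set of pairwise commuting $r$-tuples in $G^r$, and $\mathcal P_G(z):=\sum_{r\ge 2}P_r(G)z^{r-2}$. For non-abelian $G$ and $m\ge2$, $c_m(G):=-\sum_{A'}\mu_2(A',G)$, the sum over all abelian subgroups $A'\le G$ with $|G:A'|=m$, where $\mu_2$ is the Möbius function of the poset (under inclusion) consisting of all abelian subgroups of $G$ together with $G$ itself. One has $P_r(G)=\sum_{m\ge2}c_m(G)m^{-r}$ (a finite sum) for all $r\ge2$. *)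

theory Defs
  imports
    "HOL-Algebra.Multiplicative_Group"
    "HOL-Computational_Algebra.Squarefree"
    "HOL-Computational_Algebra.Formal_Power_Series"
begin

definition moebius :: "nat \<Rightarrow> int" where
  "moebius n = (if squarefree n then (- 1) ^ card (prime_factors n) else 0)"

(* Moebius function of a finite poset P (with the order of the ambient type): mu(x,x) = 1,
   and the sum of mu(x,z) over x <= z <= y vanishes for x < y.  Junk value 0 unless P is
   finite, x and y lie in P and x <= y. *)
function poset_moebius :: "'a::order set \<Rightarrow> 'a \<Rightarrow> 'a \<Rightarrow> int" where
  "poset_moebius P x y =
     (if finite P \<and> x \<in> P \<and> y \<in> P \<and> x \<le> y then
        if x = y then 1
        else - (\<Sum>z\<in>{z \<in> P. x \<le> z \<and> z < y}. poset_moebius P x z)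
      else 0)"
  by auto
termination
proof (relation "measure (\<lambda>(P, x, y). card {w \<in> P. w < y})")
  show "((P, x, z), (P, x, y)) \<in> measure (\<lambda>(P, x, y). card {w \<in> P. w < y})"
    if fin: "finite P \<and> x \<in> P \<and> y \<in> P \<and> x \<le> y" and "x \<noteq> y"
      and z: "z \<in> {z \<in> P. x \<le> z \<and> z < y}" for P and x y z :: "'a::order"
  proof -
    have "{w \<in> P. w < z} \<subset> {w \<in> P. w < y}"
      using z by (auto dest: less_trans)
    then show ?thesis
      using fin by (simp add: psubset_card_mono)
  qed
qed auto

declare poset_moebius.simps [simp del]

definition subgroup_index :: "('a, 'b) monoid_scheme \<Rightarrow> 'a set \<Rightarrow> nat" where
  "subgroup_index G H = card (rcosets\<^bsub>G\<^esub> H)"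

definition abelian_subgroups :: "('a, 'b) monoid_scheme \<Rightarrow> 'a set set" where
  "abelian_subgroups G = {H. subgroup H G \<and> comm_group (G\<lparr>carrier := H\<rparr>)}"

definition mu2 :: "('a, 'b) monoid_scheme \<Rightarrow> 'a set \<Rightarrow> 'a set \<Rightarrow> int" where
  "mu2 G = poset_moebius (abelian_subgroups G \<union> {carrier G})"

definition c_coeff :: "('a, 'b) monoid_scheme \<Rightarrow> nat \<Rightarrow> int" where
  "c_coeff G m =
     - (\<Sum>H\<in>{H \<in> abelian_subgroups G. subgroup_index G H = m}. mu2 G H (carrier G))"

definition commuting_tuples :: "('a, 'b) monoid_scheme \<Rightarrow> nat \<Rightarrow> (nat \<Rightarrow> 'a) set" where
  "commuting_tuples G r =
     {g \<in> {..<r} \<rightarrow>\<^sub>E carrier G. \<forall>i<r. \<forall>j<r. g i \<otimes>\<^bsub>G\<^esub> g j = g j \<otimes>\<^bsub>G\<^esub> g i}"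

definition commuting_prob :: "('a, 'b) monoid_scheme \<Rightarrow> nat \<Rightarrow> real" where
  "commuting_prob G r = real (card (commuting_tuples G r)) / real (order G) ^ r"

definition commuting_gf :: "('a, 'b) monoid_scheme \<Rightarrow> real fps" where
  "commuting_gf G = Abs_fps (\<lambda>k. commuting_prob G (k + 2))"

definition semidirect_product :: "('a, 'b) monoid_scheme \<Rightarrow> 'a set \<Rightarrow> 'a set \<Rightarrow> bool" where
  "semidirect_product G N K \<longleftrightarrow>
     N \<lhd> G \<and> subgroup K G \<and> N \<inter> K = {\<one>\<^bsub>G\<^esub>} \<and> N <#>\<^bsub>G\<^esub> K = carrier G"

(* The complement acts on the normal factor by conjugation. *)
definition fixed_points :: "('a, 'b) monoid_scheme \<Rightarrow> 'a set \<Rightarrow> 'a set \<Rightarrow> 'a set" where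
  "fixed_points G A B = {a \<in> A. \<forall>b\<in>B. b \<otimes>\<^bsub>G\<^esub> a \<otimes>\<^bsub>G\<^esub> inv\<^bsub>G\<^esub> b = a}"

end

theory Submission
  imports Defs "HOL-Computational_Algebra.Polynomial"
begin

text \<open>
  Write \<open>C(e)\<close> for the centralizer of \<open>t\<^sup>e\<close> in \<open>A\<close>. Let the level \<open>e\<close> of a tuple in \<open>G\<close> be the gcd of
  \<open>\<omega>\<close> and of the exponents of \<open>t\<close> in its entries, so that the tuple projects onto generators of
  \<open>\<langle>t\<^sup>e\<rangle>\<close>. If a tuple of level \<open>e\<close> commutes, then exactly \<open>|C(e)|\<close> elements \<open>h\<close> of the coset \<open>A t\<^sup>e\<close>
  commute with all its entries; if it does not commute, no such \<open>h\<close> exists, because the elements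
  lying over \<open>\<langle>t\<^sup>e\<rangle>\<close> that commute with \<open>h\<close> form the abelian group generated by \<open>C(e)\<close> and \<open>h\<close>. Counting
  pairs (tuple, \<open>h\<close>) and sieving for the exact level with the arithmetic Moebius function gives the
  number of commuting tuples, hence the generating function.

  Moebius inversion over the poset of abelian subgroups expresses the same number by the
  \<open>c\<^sub>m\<close>. As the functions \<open>r \<mapsto> m\<^sup>-\<^sup>r\<close> are linearly independent, the two expansions have the same
  coefficients.
\<close>

section \<open>The arithmetic Moebius function summed over divisors\<close>

lemma moebius_prime_mult:
  assumes "prime p" "squarefree d" "\<not> p dvd d"
  shows "moebius (p * d) = - moebius d"
proof -
  have "d \<noteq> 0" using assms(2) by (metis not_squarefree_0)
  have "coprime p d" using assms by (simp add: prime_imp_coprime)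
  then have "squarefree (p * d)"
    using assms by (simp add: squarefree_mult_coprime squarefree_prime)
  moreover have "prime_factors (p * d) = insert p (prime_factors d)"
    using assms(1) \<open>d \<noteq> 0\<close> by (subst prime_factors_product) (auto simp: prime_factorization_prime)
  moreover have "p \<notin> prime_factors d" using assms(3) by auto
  ultimately show ?thesis using assms(2) by (simp add: moebius_def)
qed

text \<open>For \<open>n > 1\<close> and a prime \<open>p\<close> dividing \<open>n\<close>,
  multiplication by \<open>p\<close> pairs the squarefree divisors prime to \<open>p\<close> with
  those divisible by \<open>p\<close> and flips the sign of \<open>moebius\<close>, so everything
  cancels.\<close>

lemma sum_moebius_divisors:
  assumes "n > 0"
  shows "(\<Sum>d | d dvd n. moebius d) = (if n = 1 then 1 else 0)"
proof (cases "n = 1")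
  case True
  then show ?thesis by (simp add: moebius_def)
next
  case False
  then obtain p where p: "prime p" "p dvd n" by (meson prime_factor_nat)
  define S where "S = {d. d dvd n \<and> squarefree d \<and> \<not> p dvd d}"
  define T where "T = {d. d dvd n \<and> squarefree d \<and> p dvd d}"
  have fin: "finite S" "finite T" "finite {d. d dvd n}"
    using assms by (auto simp: S_def T_def)
  have T: "T = (*) p ` S"
  proof (intro equalityI subsetI)
    fix d assume d: "d \<in> T"
    then obtain d' where d': "d = p * d'" by (auto simp: T_def)
    have "\<not> p dvd d'"
    proof
      assume "p dvd d'"
      then have "p ^ 2 dvd d" unfolding d' by (simp add: power2_eq_square mult_dvd_mono)
      moreover have "squarefree d" using d by (simp add: T_def)
      ultimately have "p dvd 1" by (rule squarefreeD[rotated])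
      then show False using p(1) by simp
    qed
    moreover have "squarefree d'" "d' dvd n"
      using d d' by (auto simp: T_def dest: squarefree_multD dvd_mult_right)
    ultimately show "d \<in> (*) p ` S" using d' by (auto simp: S_def)
  next
    fix d assume "d \<in> (*) p ` S"
    then obtain d' where d': "d = p * d'" "d' dvd n" "squarefree d'" "\<not> p dvd d'"
      by (auto simp: S_def)
    have "coprime p d'" using p(1) d'(4) by (simp add: prime_imp_coprime)
    then show "d \<in> T" using p d' unfolding T_def
      by (simp add: squarefree_mult_coprime squarefree_prime divides_mult)
  qed
  \<comment> \<open>Divisors that are not squarefree contribute 0, so only \<open>S\<close> and
    \<open>T\<close> remain.\<close>
  have "(\<Sum>d | d dvd n. moebius d) = (\<Sum>d\<in>S \<union> T. moebius d)"
    using fin(3) by (intro sum.mono_neutral_right) (auto simp: S_def T_def moebius_def)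
  also have "\<dots> = (\<Sum>d\<in>S. moebius d) + (\<Sum>d\<in>T. moebius d)"
    using fin by (intro sum.union_disjoint) (auto simp: S_def T_def)
  also have "(\<Sum>d\<in>T. moebius d) = (\<Sum>d\<in>S. moebius (p * d))"
    unfolding T using p(1) by (intro sum.reindex_cong[of "(*) p"]) (auto simp: inj_on_def)
  also have "\<dots> = (\<Sum>d\<in>S. - moebius d)"
    using p(1) by (intro sum.cong) (auto simp: S_def moebius_prime_mult)
  finally show ?thesis using False by (simp add: sum_negf)
qed

section \<open>Summation over an interval of a finite poset, in either argument of its Moebius
  function\<close>

lemma poset_moebius_sum_second:
  assumes "finite P" "x \<in> P" "y \<in> P" "x \<le> y"
  shows "(\<Sum>z\<in>{z \<in> P. x \<le> z \<and> z \<le> y}. poset_moebius P x z) = (if x = y then 1 else 0)"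
proof (cases "x = y")
  case True
  then have "{z \<in> P. x \<le> z \<and> z \<le> y} = {x}" using assms by auto
  then show ?thesis using True assms by (simp add: poset_moebius.simps)
next
  case False
  have "{z \<in> P. x \<le> z \<and> z \<le> y} = insert y {z \<in> P. x \<le> z \<and> z < y}"
    using assms by auto
  then show ?thesis
    using False assms by (simp add: poset_moebius.simps[of P x y])
qed

text \<open>Summing the left-hand sides over all upper ends \<open>w\<close> of the interval and exchanging the sums
  gives 1, whatever the top element is; so all terms but the one with \<open>w = x\<close> vanish.\<close>
lemma poset_moebius_sum_first:
  assumes "finite P" "x \<in> P" "y \<in> P" "x \<le> y"
  shows "(\<Sum>z\<in>{z \<in> P. x \<le> z \<and> z \<le> y}. poset_moebius P z y) = (if x = y then 1 else 0)"
  using assms(3,4)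
proof (induction "card {w \<in> P. w < y}" arbitrary: y rule: less_induct)
  case less
  define f where "f w = (\<Sum>z\<in>{z \<in> P. x \<le> z \<and> z \<le> w}. poset_moebius P z w)" for w
  have f: "f w = (if x = w then 1 else 0)" if "w \<in> P" "x \<le> w" "w < y" for w
    unfolding f_def
  proof (rule less.hyps)
    have "{v \<in> P. v < w} \<subset> {v \<in> P. v < y}" using that by (auto dest: less_trans)
    then show "card {v \<in> P. v < w} < card {v \<in> P. v < y}"
      using assms(1) by (simp add: psubset_card_mono)
  qed (use that in auto)
  show ?case
  proof (cases "x = y")
    case True
    then have "{z \<in> P. x \<le> z \<and> z \<le> y} = {x}" using assms by auto
    then show ?thesis using True assms by (simp add: poset_moebius.simps)
  next
    case False
    let ?I = "{z \<in> P. x \<le> z \<and> z \<le> y}"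
    have fin: "finite ?I" using assms(1) by simp
    have "(\<Sum>w\<in>?I. f w) = (\<Sum>w\<in>?I. \<Sum>z\<in>?I. if z \<le> w then poset_moebius P z w else 0)"
      unfolding f_def using fin
      by (intro sum.cong refl sum.mono_neutral_cong_left) (auto dest: order_trans)
    also have "\<dots> = (\<Sum>z\<in>?I. \<Sum>w\<in>?I. if z \<le> w then poset_moebius P z w else 0)"
      by (rule sum.swap)
    also have "\<dots> = (\<Sum>z\<in>?I. \<Sum>w\<in>{w \<in> P. z \<le> w \<and> w \<le> y}. poset_moebius P z w)"
      using fin
      by (intro sum.cong refl sum.mono_neutral_cong_right) (auto dest: order_trans)
    also have "\<dots> = (\<Sum>z\<in>?I. if z = y then 1 else 0)"
      using assms(1) less.prems by (intro sum.cong refl poset_moebius_sum_second) auto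
    also have "\<dots> = 1" using fin less.prems by simp
    finally have "(\<Sum>w\<in>?I. f w) = 1" .
    moreover have "?I = insert y {w \<in> P. x \<le> w \<and> w < y}" using less.prems by auto
    ultimately have "f y + (\<Sum>w\<in>{w \<in> P. x \<le> w \<and> w < y}. f w) = 1"
      using assms(1) by simp
    moreover have "(\<Sum>w\<in>{w \<in> P. x \<le> w \<and> w < y}. f w)
        = (\<Sum>w\<in>{w \<in> P. x \<le> w \<and> w < y}. if x = w then 1 else 0)"
      by (intro sum.cong) (auto simp: f)
    moreover have "\<dots> = 1"
      using assms False less.prems by (simp add: order_less_le)
    ultimately show ?thesis using False unfolding f_def by simp
  qed
qed

section \<open>Uniqueness of coefficients in sums of powers, and the geometric series\<close>

text \<open>Linear combinations of the given relations replace the powers by an arbitrary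
  polynomial; one that vanishes at all nodes except \<open>x j\<close> isolates
  \<open>a j\<close>.\<close>

lemma power_sums_eq_zero_imp:
  fixes a x :: "'i \<Rightarrow> real"
  assumes "finite S" "inj_on x S" "\<And>r. r \<ge> 2 \<Longrightarrow> (\<Sum>i\<in>S. a i * x i ^ r) = 0"
    and "j \<in> S" "x j \<noteq> 0"
  shows "a j = 0"
proof -
  \<comment> \<open>The relations start at \<open>r = 2\<close>, hence the factor
    \<open>x i ^ 2\<close>; the assumption \<open>x j \<noteq> 0\<close> removes it at the
    end.\<close>
  have poly: "(\<Sum>i\<in>S. a i * x i ^ 2 * poly p (x i)) = 0" for p :: "real poly"
  proof -
    have "(\<Sum>i\<in>S. a i * x i ^ 2 * poly p (x i))
        = (\<Sum>i\<in>S. \<Sum>k\<le>Polynomial.degree p. Polynomial.coeff p k * (a i * x i ^ (k + 2)))"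
      by (intro sum.cong refl)
         (simp add: poly_altdef sum_distrib_left power_add power2_eq_square algebra_simps)
    also have "\<dots> = (\<Sum>k\<le>Polynomial.degree p. Polynomial.coeff p k * (\<Sum>i\<in>S. a i * x i ^ (k + 2)))"
      by (subst sum.swap) (simp add: sum_distrib_left)
    also have "\<dots> = 0" using assms(3)[of "_ + 2"] by simp
    finally show ?thesis .
  qed
  define p where "p = (\<Prod>i\<in>S - {j}. [:- x i, 1:])"
  have p: "poly p y = (\<Prod>i\<in>S - {j}. y - x i)" for y
    by (simp add: p_def poly_prod)
  have "0 = (\<Sum>i\<in>S. a i * x i ^ 2 * poly p (x i))" using poly by simp
  also have "\<dots> = a j * x j ^ 2 * poly p (x j) + (\<Sum>i\<in>S - {j}. a i * x i ^ 2 * poly p (x i))"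
    using assms(1,4) by (rule sum.remove)
  also have "(\<Sum>i\<in>S - {j}. a i * x i ^ 2 * poly p (x i)) = 0"
    using assms(1) by (intro sum.neutral) (auto simp: p prod_zero_iff)
  finally have "a j * x j ^ 2 * poly p (x j) = 0" by simp
  moreover have "poly p (x j) \<noteq> 0"
    using assms(1,2,4) by (auto simp: p prod_zero_iff inj_on_def)
  ultimately show ?thesis using assms(5) by simp
qed

lemma inverse_power_sums_unique:
  fixes a b :: "nat \<Rightarrow> real"
  assumes "finite S" "0 \<notin> S" "j \<in> S"
    and "\<And>r. r \<ge> 2 \<Longrightarrow> (\<Sum>m\<in>S. a m / real m ^ r) = (\<Sum>m\<in>S. b m / real m ^ r)"
  shows "a j = b j"
proof -
  have "a j - b j = 0"
  proof (rule power_sums_eq_zero_imp[where S = S and x = "\<lambda>m. 1 / real m" and a = "\<lambda>m. a m - b m"])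
    show "inj_on (\<lambda>m. 1 / real m) S" by (auto simp: inj_on_def)
    show "1 / real j \<noteq> 0" using assms(2,3) by (cases "j = 0") auto
    show "(\<Sum>m\<in>S. (a m - b m) * (1 / real m) ^ r) = 0" if "r \<ge> 2" for r
      using assms(4)[OF that]
      by (simp add: left_diff_distrib diff_divide_distrib sum_subtractf power_one_over)
  qed (use assms in auto)
  then show ?thesis by simp
qed

text \<open>The geometric series, checked by multiplying the candidate series by the denominator.
  The shift by 2 is the one in \<open>commuting_gf\<close>, so the formula for the generating
  function can be compared coefficientwise with the commuting probabilities.\<close>

lemma fps_const_divide_linear_nth:
  fixes c M :: "'a :: field"
  assumes "M \<noteq> 0"
  shows "fps_nth (fps_const c / (fps_const M * (fps_const M - fps_X))) k = c / M ^ (k + 2)"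
proof -
  let ?D = "fps_const M * (fps_const M - fps_X)"
  define F where "F = Abs_fps (\<lambda>k. c / M ^ (k + 2))"
  have "F * ?D = fps_const c"
  proof (rule fps_ext)
    fix n
    have "F * ?D = fps_const M * (fps_const M * F - fps_X * F)"
      by (simp add: algebra_simps)
    then show "fps_nth (F * ?D) n = fps_nth (fps_const c) n"
      using assms by (cases n) (auto simp: F_def field_simps power2_eq_square)
  qed
  moreover have "fps_nth ?D 0 \<noteq> 0" using assms by simp
  ultimately have "fps_const c / ?D = F"
    by (metis fps_divide_times_eq fps_nonzeroI mult.commute nonzero_mult_div_cancel_right)
  then show ?thesis by (simp add: F_def)
qed

section \<open>Abelian subgroups, and Moebius inversion for commuting tuples\<close>

definition centralizer :: "('a, 'b) monoid_scheme \<Rightarrow> 'a set \<Rightarrow> 'a set" where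
  "centralizer G S = {x \<in> carrier G. \<forall>s\<in>S. x \<otimes>\<^bsub>G\<^esub> s = s \<otimes>\<^bsub>G\<^esub> x}"

lemma centralizerD: "x \<in> centralizer G S \<Longrightarrow> s \<in> S \<Longrightarrow> x \<otimes>\<^bsub>G\<^esub> s = s \<otimes>\<^bsub>G\<^esub> x"
  by (simp add: centralizer_def)

lemma (in group) subgroup_centralizer:
  assumes "S \<subseteq> carrier G"
  shows "subgroup (centralizer G S) G"
proof (rule subgroupI)
  show "centralizer G S \<subseteq> carrier G" by (auto simp: centralizer_def)
  show "centralizer G S \<noteq> {}" using assms by (auto simp: centralizer_def intro!: exI[of _ \<one>])
  fix x assume x: "x \<in> centralizer G S"
  then have xc: "x \<in> carrier G" by (simp add: centralizer_def)
  have "inv x \<otimes> s = s \<otimes> inv x" if "s \<in> S" for s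
  proof -
    have s: "s \<in> carrier G" using that assms by auto
    have "inv x \<otimes> (s \<otimes> x) \<otimes> inv x = inv x \<otimes> (x \<otimes> s) \<otimes> inv x"
      using centralizerD[OF x that] by simp
    then show ?thesis using s xc by (simp add: m_assoc inv_solve_left')
  qed
  then show "inv x \<in> centralizer G S" using xc by (simp add: centralizer_def)
  fix y assume y: "y \<in> centralizer G S"
  then have yc: "y \<in> carrier G" by (simp add: centralizer_def)
  have "x \<otimes> y \<otimes> s = s \<otimes> (x \<otimes> y)" if "s \<in> S" for s
  proof -
    have s: "s \<in> carrier G" using that assms by auto
    have "x \<otimes> y \<otimes> s = x \<otimes> (s \<otimes> y)" using s xc yc centralizerD[OF y that] by (simp add: m_assoc)
    also have "\<dots> = s \<otimes> x \<otimes> y"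
      using s xc yc centralizerD[OF x that] by (simp add: m_assoc[symmetric])
    finally show ?thesis using s xc yc by (simp add: m_assoc)
  qed
  then show "x \<otimes> y \<in> centralizer G S" using xc yc by (simp add: centralizer_def)
qed

lemma (in group) abelian_subgroups_iff:
  "H \<in> abelian_subgroups G \<longleftrightarrow> subgroup H G \<and> (\<forall>x\<in>H. \<forall>y\<in>H. x \<otimes> y = y \<otimes> x)"
proof -
  have "comm_group (G\<lparr>carrier := H\<rparr>) \<longleftrightarrow> (\<forall>x\<in>H. \<forall>y\<in>H. x \<otimes> y = y \<otimes> x)" if "subgroup H G"
  proof
    assume "comm_group (G\<lparr>carrier := H\<rparr>)"
    then show "\<forall>x\<in>H. \<forall>y\<in>H. x \<otimes> y = y \<otimes> x"
      using comm_groupE(4)[of "G\<lparr>carrier := H\<rparr>"] by auto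
  next
    assume "\<forall>x\<in>H. \<forall>y\<in>H. x \<otimes> y = y \<otimes> x"
    then show "comm_group (G\<lparr>carrier := H\<rparr>)"
      using subgroup_imp_group[OF that] by (auto intro: group.group_comm_groupI)
  qed
  then show ?thesis by (auto simp: abelian_subgroups_def)
qed

text \<open>Centralizers are subgroups, so commutation passes from \<open>S\<close> to the generated
  subgroup in one argument at a time: \<open>S\<close> centralizes \<open>S\<close>, then
  \<open>generate G S\<close> centralizes \<open>S\<close>, then it centralizes itself.\<close>

lemma (in group) generate_mem_abelian_subgroups:
  assumes "S \<subseteq> carrier G" "\<And>x y. x \<in> S \<Longrightarrow> y \<in> S \<Longrightarrow> x \<otimes> y = y \<otimes> x"
  shows "generate G S \<in> abelian_subgroups G"
proof -
  let ?H = "generate G S"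
  have H: "subgroup ?H G" "?H \<subseteq> carrier G"
    using generate_is_subgroup[OF assms(1)] generate_incl[OF assms(1)] by auto
  have "S \<subseteq> centralizer G S" using assms by (auto simp: centralizer_def)
  then have "?H \<subseteq> centralizer G S"
    using subgroup_centralizer[OF assms(1)] by (rule generate_subgroup_incl)
  then have "S \<subseteq> centralizer G ?H"
    using assms(1) by (auto simp: centralizer_def)
  then have "?H \<subseteq> centralizer G ?H"
    using subgroup_centralizer[OF H(2)] by (rule generate_subgroup_incl)
  then show ?thesis using H by (auto simp: abelian_subgroups_iff centralizer_def)
qed

text \<open>The abelian subgroups containing a commuting tuple are those above the subgroup it
  generates. Together with \<open>carrier G\<close> they form an interval on which
  \<open>mu2\<close> sums to 0; the top contributes 1, so each commuting tuple receives total weight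
  -1 from the abelian subgroups.\<close>

lemma (in group) card_commuting_tuples_eq_sum_mu2:
  assumes "finite (carrier G)" "\<not> comm_group G"
  shows "int (card (commuting_tuples G r))
    = - (\<Sum>H\<in>abelian_subgroups G. mu2 G H (carrier G) * int (card H) ^ r)"
proof -
  let ?U = "abelian_subgroups G" and ?T = "commuting_tuples G r"
  have U: "H \<subseteq> carrier G" if "H \<in> ?U" for H
    using that subgroup.subset by (auto simp: abelian_subgroups_def)
  then have finU: "finite ?U" using assms(1) by (meson Pow_iff finite_Pow_iff finite_subset subsetI)
  have finH: "finite H" if "H \<in> ?U" for H using U[OF that] assms(1) by (rule finite_subset)
  have GU: "carrier G \<notin> ?U"
    using assms(2) by (auto simp: abelian_subgroups_def)
  have finT: "finite ?T"
    using assms(1) by (intro finite_subset[OF _ finite_PiE[of "{..<r}" "\<lambda>_. carrier G"]])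
      (auto simp: commuting_tuples_def)
  have mu: "(\<Sum>H\<in>{H \<in> ?U. g \<in> {..<r} \<rightarrow>\<^sub>E H}. mu2 G H (carrier G)) = -1" if g: "g \<in> ?T" for g
  proof -
    define S where "S = generate G (g ` {..<r})"
    have S: "S \<in> ?U" unfolding S_def
      using g by (intro generate_mem_abelian_subgroups) (auto simp: commuting_tuples_def)
    have "{z \<in> ?U \<union> {carrier G}. S \<le> z \<and> z \<le> carrier G}
        = insert (carrier G) {H \<in> ?U. g \<in> {..<r} \<rightarrow>\<^sub>E H}"
    proof -
      have "S \<subseteq> H \<longleftrightarrow> g \<in> {..<r} \<rightarrow>\<^sub>E H" if "H \<in> ?U" for H
      proof
        assume "S \<subseteq> H"
        moreover have "g ` {..<r} \<subseteq> S" unfolding S_def by (auto intro: generate.incl)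
        ultimately show "g \<in> {..<r} \<rightarrow>\<^sub>E H" using g by (auto simp: commuting_tuples_def PiE_def)
      next
        assume "g \<in> {..<r} \<rightarrow>\<^sub>E H"
        then show "S \<subseteq> H" unfolding S_def using that
          by (intro generate_subgroup_incl) (auto simp: abelian_subgroups_def)
      qed
      then show ?thesis using S by (auto dest: U[THEN subsetD])
    qed
    \<comment> \<open>As \<open>S\<close> is abelian and \<open>G\<close> is not, the interval has
      distinct ends, so its sum is 0 and not 1.\<close>
    moreover have "(\<Sum>z\<in>{z \<in> ?U \<union> {carrier G}. S \<le> z \<and> z \<le> carrier G}. mu2 G z (carrier G)) = 0"
      unfolding mu2_def using finU S U GU by (subst poset_moebius_sum_first) auto
    moreover have "mu2 G (carrier G) (carrier G) = 1"
      unfolding mu2_def using finU by (simp add: poset_moebius.simps)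
    ultimately show ?thesis using finU GU by simp
  qed
  have "(\<Sum>H\<in>?U. mu2 G H (carrier G) * int (card H) ^ r)
      = (\<Sum>H\<in>?U. \<Sum>g\<in>{..<r} \<rightarrow>\<^sub>E H. mu2 G H (carrier G))"
    by (intro sum.cong refl) (simp add: card_PiE)
  also have "\<dots> = (\<Sum>H\<in>?U. \<Sum>g\<in>?T. if g \<in> {..<r} \<rightarrow>\<^sub>E H then mu2 G H (carrier G) else 0)"
  \<comment> \<open>Every tuple with entries in an abelian subgroup commutes, so the inner sum may
    run over all of \<open>?T\<close> with an indicator, which lets the two sums be
    exchanged.\<close>
  proof (rule sum.cong[OF refl], rule sum.mono_neutral_cong_left[OF finT])
    fix H assume H: "H \<in> ?U"
    then have com: "\<forall>x\<in>H. \<forall>y\<in>H. x \<otimes> y = y \<otimes> x" by (simp add: abelian_subgroups_iff)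
    show "({..<r} \<rightarrow>\<^sub>E H) \<subseteq> ?T"
    proof
      fix g assume g: "g \<in> {..<r} \<rightarrow>\<^sub>E H"
      then have "g i \<in> H" if "i < r" for i using that by auto
      then show "g \<in> ?T" using g com U[OF H] by (auto simp: commuting_tuples_def PiE_iff)
    qed
  qed auto
  also have "\<dots> = (\<Sum>g\<in>?T. \<Sum>H\<in>?U. if g \<in> {..<r} \<rightarrow>\<^sub>E H then mu2 G H (carrier G) else 0)"
    by (rule sum.swap)
  also have "\<dots> = (\<Sum>g\<in>?T. -1)"
    using mu finU by (intro sum.cong refl) (simp add: sum.inter_filter[symmetric])
  finally show ?thesis by simp
qed

text \<open>A nonempty set of integers closed under differences is an additive group, so Bezout puts
  gcds into it. It serves to carry a property from the exponents of the entries of a tuple to the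
  level of the tuple.\<close>

lemma Gcd_mem_diff_closed:
  fixes I :: "int set"
  assumes I: "\<And>i j. i \<in> I \<Longrightarrow> j \<in> I \<Longrightarrow> i - j \<in> I"
    and K: "finite K" "K \<noteq> {}" "int ` K \<subseteq> I"
  shows "int (Gcd K) \<in> I"
proof -
  have zero: "0 \<in> I" using K I by fastforce
  have neg: "- i \<in> I" if "i \<in> I" for i using I[OF zero that] by simp
  have add: "i + j \<in> I" if "i \<in> I" "j \<in> I" for i j using I[OF that(1) neg[OF that(2)]] by simp
  have mult_nat: "int k * i \<in> I" if "i \<in> I" for k i
    by (induction k) (auto simp: zero add that algebra_simps)
  have mult: "k * i \<in> I" if "i \<in> I" for k i
    using mult_nat[OF that, of "nat k"] neg[OF mult_nat[OF that, of "nat (- k)"]]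
    by (cases "k \<ge> 0") auto
  show ?thesis using K
  proof (induction K rule: finite_ne_induct)
    case (insert k K)
    obtain u v where "u * int k + v * int (Gcd K) = gcd (int k) (int (Gcd K))"
      using bezout_int by blast
    then show ?case using insert add mult by (metis Gcd_insert gcd_int_int_eq image_insert insert_subset)
  qed simp
qed

section \<open>The semidirect product as a union of cosets of \<open>A\<close> over the powers of
  \<open>t\<close>\<close>

locale abelian_by_cyclic = group G for G (structure) +
  fixes A :: "'a set" and t :: 'a and \<omega> :: nat
  assumes t_closed [simp, intro]: "t \<in> carrier G"
    and semidirect: "semidirect_product G A (generate G {t})"
    and finite_A: "finite A"
    and comm_A: "comm_group (G\<lparr>carrier := A\<rparr>)"
    and ord_t: "ord t = \<omega>"
    and \<omega>_pos: "\<omega> > 0"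
begin

lemma normal_A: "A \<lhd> G"
  using semidirect by (simp add: semidirect_product_def)

lemma subgroup_A: "subgroup A G"
  using normal_A by (rule normal_imp_subgroup)

lemma A_closed [simp, intro]: "a \<in> A \<Longrightarrow> a \<in> carrier G"
  using subgroup.subset[OF subgroup_A] by auto

lemma A_commute: "a \<in> A \<Longrightarrow> b \<in> A \<Longrightarrow> a \<otimes> b = b \<otimes> a"
  using comm_A subgroup_A abelian_subgroups_iff[of A] by (auto simp: abelian_subgroups_def)

text \<open>Exponents are integers and not residues, so that inverses and Bezout combinations need
  no reduction modulo \<open>\<omega>\<close>.\<close>

definition fibre :: "int \<Rightarrow> 'a set" where
  "fibre j = A #> t [^] j"

lemma fibre_subset: "fibre j \<subseteq> carrier G"
  unfolding fibre_def by (intro r_coset_subset_G) auto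

lemma fibre_closed: "x \<in> fibre j \<Longrightarrow> x \<in> carrier G"
  using fibre_subset by auto

lemma fibreE:
  assumes "x \<in> fibre j"
  obtains a where "a \<in> A" "x = a \<otimes> t [^] j"
  using assms by (auto simp: fibre_def r_coset_def)

lemma fibreI: "a \<in> A \<Longrightarrow> a \<otimes> t [^] j \<in> fibre j"
  by (auto simp: fibre_def r_coset_def)

lemma fibre_0: "fibre 0 = A"
  by (simp add: fibre_def) (auto simp: r_coset_def)

lemma pow_mem_fibre: "t [^] j \<in> fibre j"
  using fibreI[of \<one> j] subgroup.one_closed[OF subgroup_A] by simp

lemma fibre_mult:
  assumes "x \<in> fibre i" "y \<in> fibre j"
  shows "x \<otimes> y \<in> fibre (i + j)"
proof -
  have "x \<otimes> y \<in> fibre i <#> fibre j" using assms by (auto simp: set_mult_def)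
  also have "\<dots> = fibre (i + j)"
    unfolding fibre_def using normal.rcos_sum[OF normal_A, of "t [^] i" "t [^] j"]
    by (simp add: int_pow_mult)
  finally show ?thesis .
qed

lemma fibre_inv:
  assumes "x \<in> fibre j"
  shows "inv x \<in> fibre (- j)"
proof -
  have "inv x \<in> set_inv (fibre j)" using assms by (auto simp: SET_INV_def)
  then show ?thesis
    unfolding fibre_def using normal.rcos_inv[OF normal_A, of "t [^] j"]
    by (simp add: int_pow_neg)
qed

lemma fibre_int_pow:
  assumes "x \<in> fibre j"
  shows "x [^] (k :: int) \<in> fibre (j * k)"
proof -
  have nat: "x [^] (n :: nat) \<in> fibre (j * int n)" for n
  proof (induction n)
    case 0
    then show ?case using subgroup.one_closed[OF subgroup_A] by (simp add: fibre_0)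
  next
    case (Suc n)
    then show ?case using fibre_mult[OF Suc assms] by (simp add: algebra_simps)
  qed
  have "x [^] int n \<in> fibre (j * int n)" "x [^] - int n \<in> fibre (j * - int n)" for n
    using nat[of n] fibre_inv[OF nat[of n]] fibre_closed[OF assms]
    by (simp_all add: int_pow_int int_pow_neg_int)
  then show ?thesis by (cases k rule: int_cases2) auto
qed

lemma ex_fibre:
  assumes "x \<in> carrier G"
  shows "\<exists>j. x \<in> fibre j"
proof -
  have "x \<in> A <#> generate G {t}" using assms semidirect by (simp add: semidirect_product_def)
  then obtain a b where ab: "a \<in> A" "b \<in> generate G {t}" "x = a \<otimes> b"
    by (auto simp: set_mult_def)
  then obtain j :: int where "b = t [^] j" using generate_pow[OF t_closed] by auto
  then show ?thesis using ab fibreI by auto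
qed

text \<open>Dividing \<open>x\<close> by itself puts \<open>\<one>\<close> over
  \<open>i - j\<close>, so \<open>t [^] (i - j)\<close> lies in both \<open>A\<close> and
  \<open>generate G {t}\<close>, which meet trivially.\<close>

lemma fibre_unique:
  assumes "x \<in> fibre i" "x \<in> fibre j"
  shows "int \<omega> dvd i - j"
proof -
  have "x \<otimes> inv x \<in> fibre (i + - j)" using assms by (intro fibre_mult fibre_inv)
  then have "\<one> \<in> fibre (i - j)" using fibre_closed[OF assms(1)] by simp
  then obtain a where a: "a \<in> A" "\<one> = a \<otimes> t [^] (i - j)" by (rule fibreE)
  then have "t [^] (i - j) = inv a"
    using inv_unique'[of a "t [^] (i - j)"] inv_equality[of a "t [^] (i - j)"] by auto
  then have "t [^] (i - j) \<in> A" using a subgroup.m_inv_closed[OF subgroup_A] by simp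
  moreover have "t [^] (i - j) \<in> generate G {t}" using generate_pow[OF t_closed] by auto
  ultimately have "t [^] (i - j) = \<one>" using semidirect by (auto simp: semidirect_product_def)
  then show ?thesis using int_pow_eq_id[OF t_closed, of "i - j"] ord_t by simp
qed

lemma fibre_disjoint:
  assumes "i < \<omega>" "j < \<omega>" "i \<noteq> j"
  shows "fibre (int i) \<inter> fibre (int j) = {}"
proof -
  have False if "x \<in> fibre (int i)" "x \<in> fibre (int j)" for x
  proof -
    have "int \<omega> dvd int i - int j" using that by (rule fibre_unique)
    then have "int i mod int \<omega> = int j mod int \<omega>" by (simp add: mod_eq_dvd_iff)
    then show False using assms by simp
  qed
  then show ?thesis by blast
qed

lemma fibre_cong:
  assumes "int \<omega> dvd i - j"
  shows "fibre i = fibre j"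
proof -
  have "t [^] i = t [^] j"
    using assms int_pow_eq[OF t_closed, of i j] ord_t by (simp add: dvd_diff_commute)
  then show ?thesis by (simp add: fibre_def)
qed

lemma pow_\<omega>: "t [^] int \<omega> = \<one>"
  using pow_ord_eq_1[OF t_closed] ord_t by (simp add: int_pow_int)

lemma card_fibre: "card (fibre j) = card A"
proof -
  have "fibre j = (\<lambda>a. a \<otimes> t [^] j) ` A" by (auto simp: fibre_def r_coset_def)
  then show ?thesis by (simp add: card_image inj_on_def)
qed

lemma finite_fibre: "finite (fibre j)"
  unfolding fibre_def r_coset_def using finite_A by auto

text \<open>The image of \<open>x\<close> in the quotient by \<open>A\<close>, cyclic of order
  \<open>\<omega>\<close>, as a reduced residue. On the carrier the choice is unique by
  \<open>fibre_disjoint\<close>.\<close>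

definition expo :: "'a \<Rightarrow> nat" where
  "expo x = (SOME j. j < \<omega> \<and> x \<in> fibre (int j))"

lemma expo:
  assumes "x \<in> carrier G"
  shows "expo x < \<omega>" "x \<in> fibre (int (expo x))"
proof -
  obtain j where j: "x \<in> fibre j" using ex_fibre[OF assms] by blast
  have "nat (j mod int \<omega>) < \<omega> \<and> x \<in> fibre (int (nat (j mod int \<omega>)))"
    using j \<omega>_pos fibre_cong[of "j mod int \<omega>" j]
    by (auto simp: nat_less_iff mod_eq_dvd_iff[symmetric])
  then have "expo x < \<omega> \<and> x \<in> fibre (int (expo x))"
    unfolding expo_def by (rule someI)
  then show "expo x < \<omega>" "x \<in> fibre (int (expo x))" by auto
qed

text \<open>Reduction modulo \<open>\<omega>\<close> does not affect divisibility by a divisor of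
  \<open>\<omega>\<close>.\<close>

lemma dvd_expo_iff:
  assumes "d dvd \<omega>" "x \<in> fibre j"
  shows "d dvd expo x \<longleftrightarrow> int d dvd j"
proof -
  have "int \<omega> dvd int (expo x) - j"
    using fibre_unique expo(2) assms(2) fibre_closed by blast
  then have "int d dvd int (expo x) - j" using assms(1) by (meson dvd_trans int_dvd_int_iff)
  then have "int d dvd int (expo x) \<longleftrightarrow> int d dvd j"
    by (metis diff_add_cancel dvd_add_right_iff)
  then show ?thesis by simp
qed

lemma carrier_eq_UN_fibre: "carrier G = (\<Union>j<\<omega>. fibre (int j))"
  using expo fibre_closed by blast

lemma finite_carrier: "finite (carrier G)"
  unfolding carrier_eq_UN_fibre using finite_fibre by simp

lemma order_eq: "Coset.order G = card A * \<omega>"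
proof -
  have "Coset.order G = card (\<Union>j<\<omega>. fibre (int j))"
    unfolding Coset.order_def carrier_eq_UN_fibre[symmetric] ..
  also have "\<dots> = (\<Sum>j<\<omega>. card (fibre (int j)))"
    using finite_fibre fibre_disjoint by (intro card_UN_disjoint) auto
  finally show ?thesis by (simp add: card_fibre)
qed

section \<open>Centralizers inside the cosets of \<open>A\<close>\<close>

text \<open>A single power of \<open>t\<close> suffices here: \<open>fixed_points_generate\<close>
  identifies this with the fixed points of the cyclic group generated by that power.\<close>

definition fixed :: "int \<Rightarrow> 'a set" where
  "fixed j = A \<inter> centralizer G {t [^] j}"

lemma subgroup_fixed: "subgroup (fixed j) G"
  unfolding fixed_def by (intro subgroups_Inter_pair subgroup_A subgroup_centralizer) auto

lemma finite_fixed: "finite (fixed j)"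
  unfolding fixed_def using finite_A by simp

lemma card_fixed_pos: "card (fixed j) > 0"
  using finite_fixed subgroup.one_closed[OF subgroup_fixed] by (auto simp: card_gt_0_iff)

text \<open>Since \<open>A\<close> is abelian, the \<open>A\<close>-part of \<open>h\<close> acts
  trivially on \<open>A\<close>, and only its exponent matters.\<close>

lemma centralizer_fibre:
  assumes "h \<in> fibre j"
  shows "A \<inter> centralizer G {h} = fixed j"
proof -
  obtain b where b: "b \<in> A" "h = b \<otimes> t [^] j" using assms by (rule fibreE)
  have "a \<otimes> h = h \<otimes> a \<longleftrightarrow> a \<otimes> t [^] j = t [^] j \<otimes> a" if a: "a \<in> A" for a
  proof -
    have "a \<otimes> h = b \<otimes> (a \<otimes> t [^] j)"
      using a b A_commute[OF a b(1)] by (simp add: m_assoc[symmetric])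
    moreover have "h \<otimes> a = b \<otimes> (t [^] j \<otimes> a)" using a b by (simp add: m_assoc)
    ultimately show ?thesis using a b by simp
  qed
  then show ?thesis by (auto simp: fixed_def centralizer_def)
qed

text \<open>One centralizing element \<open>x0\<close> in the fibre is enough: right translation by
  \<open>x0\<close> then maps \<open>A \<inter> centralizer G S\<close> bijectively onto the
  centralizing elements of the fibre.\<close>

lemma card_fibre_centralizer:
  assumes "S \<subseteq> carrier G" "x0 \<in> fibre j" "x0 \<in> centralizer G S"
  shows "card (fibre j \<inter> centralizer G S) = card (A \<inter> centralizer G S)"
proof -
  note Z = subgroup_centralizer[OF assms(1)]
  have x0: "x0 \<in> carrier G" using assms(2) by (rule fibre_closed)
  have "fibre j \<inter> centralizer G S = (\<lambda>c. c \<otimes> x0) ` (A \<inter> centralizer G S)"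
  proof (intro equalityI subsetI)
    fix x assume x: "x \<in> fibre j \<inter> centralizer G S"
    then have xc: "x \<in> carrier G" using fibre_closed by auto
    have "x \<otimes> inv x0 \<in> fibre (j + - j)" using x assms(2) by (intro fibre_mult fibre_inv) auto
    moreover have "x \<otimes> inv x0 \<in> centralizer G S"
      using x assms(3) by (intro subgroup.m_closed[OF Z] subgroup.m_inv_closed[OF Z]) auto
    moreover have "x = x \<otimes> inv x0 \<otimes> x0" using xc x0 by (simp add: m_assoc)
    ultimately show "x \<in> (\<lambda>c. c \<otimes> x0) ` (A \<inter> centralizer G S)"
      by (auto simp: fibre_0)
  next
    fix x assume "x \<in> (\<lambda>c. c \<otimes> x0) ` (A \<inter> centralizer G S)"
    then obtain c where c: "c \<in> A" "c \<in> centralizer G S" "x = c \<otimes> x0" by auto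
    then show "x \<in> fibre j \<inter> centralizer G S"
      using fibre_mult[of c 0 x0 j] assms(2,3) subgroup.m_closed[OF Z] by (auto simp: fibre_0)
  qed
  moreover have "inj_on (\<lambda>c. c \<otimes> x0) (A \<inter> centralizer G S)"
    using x0 by (auto simp: inj_on_def)
  ultimately show ?thesis by (simp add: card_image)
qed

text \<open>Dividing \<open>x\<close> by \<open>h [^] i\<close> leaves an element of
  \<open>A\<close> commuting with \<open>h\<close>, hence in \<open>fixed e\<close>. So
  \<open>x\<close>, and likewise \<open>y\<close>, lies in the subgroup generated by
  \<open>h\<close> and \<open>fixed e\<close>, whose generators commute.\<close>

lemma commute_over_generator:
  assumes h: "h \<in> fibre e" and x: "x \<in> centralizer G {h}" "x \<in> fibre (e * i)"
    and y: "y \<in> centralizer G {h}" "y \<in> fibre (e * j)"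
  shows "x \<otimes> y = y \<otimes> x"
proof -
  have hc: "h \<in> carrier G" using h by (rule fibre_closed)
  have S: "subgroup (centralizer G {h}) G" using hc by (intro subgroup_centralizer) auto
  define S where "S = insert h (fixed e)"
  have Sc: "S \<subseteq> carrier G" using hc by (auto simp: S_def fixed_def)
  have com: "u \<otimes> v = v \<otimes> u" if "u \<in> S" "v \<in> S" for u v
  proof -
    have "c \<in> A" "c \<otimes> h = h \<otimes> c" if "c \<in> fixed e" for c
      using that centralizer_fibre[OF h] by (auto simp: centralizer_def)
    then show ?thesis using that A_commute by (auto simp: S_def)
  qed
  have in_gen: "z \<in> generate G S" if "z \<in> centralizer G {h}" "z \<in> fibre (e * k)" for z k
  proof -
    have zc: "z \<in> carrier G" using that(2) by (rule fibre_closed)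
    have hZ: "h [^] k \<in> centralizer G {h}"
      using hc by (intro subgroup_int_pow_closed[OF S]) (auto simp: centralizer_def)
    have "z \<otimes> inv (h [^] k) \<in> fibre (e * k + - (e * k))"
      using that h by (intro fibre_mult fibre_inv fibre_int_pow)
    moreover have "z \<otimes> inv (h [^] k) \<in> centralizer G {h}"
      using that hZ by (intro subgroup.m_closed[OF S] subgroup.m_inv_closed[OF S])
    ultimately have "z \<otimes> inv (h [^] k) \<in> S"
      using centralizer_fibre[OF h] by (auto simp: fibre_0 S_def)
    then have "z \<otimes> inv (h [^] k) \<in> generate G S" by (rule generate.incl)
    moreover have "h [^] k \<in> generate G S"
      by (intro subgroup_int_pow_closed[OF generate_is_subgroup[OF Sc]] generate.incl)
         (simp add: S_def)
    ultimately have "z \<otimes> inv (h [^] k) \<otimes> h [^] k \<in> generate G S" by (rule generate.eng)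
    then show ?thesis using zc hc by (simp add: m_assoc)
  qed
  have "generate G S \<in> abelian_subgroups G"
    using Sc com by (rule generate_mem_abelian_subgroups)
  then show ?thesis using in_gen x y by (auto simp: abelian_subgroups_iff)
qed

section \<open>The level of a tuple, and the elements over it that centralize the tuple\<close>

text \<open>Inserting \<open>\<omega>\<close> makes the level a divisor of \<open>\<omega>\<close>,
  also for tuples with all entries in \<open>A\<close> and for the empty tuple, where it equals
  \<open>\<omega>\<close>.\<close>

definition level :: "nat \<Rightarrow> (nat \<Rightarrow> 'a) \<Rightarrow> nat" where
  "level r g = Gcd (insert \<omega> ((\<lambda>i. expo (g i)) ` {..<r}))"

lemma dvd_level_iff: "d dvd level r g \<longleftrightarrow> d dvd \<omega> \<and> (\<forall>i<r. d dvd expo (g i))"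
  by (auto simp: level_def dvd_Gcd_iff)

lemma level_dvd: "level r g dvd \<omega>"
  using dvd_level_iff[of "level r g" r g] by simp

lemma level_mem_diff_closed:
  fixes I :: "int set"
  assumes "\<And>i j. i \<in> I \<Longrightarrow> j \<in> I \<Longrightarrow> i - j \<in> I"
    and "int \<omega> \<in> I" "\<And>i. i < r \<Longrightarrow> int (expo (g i)) \<in> I"
  shows "int (level r g) \<in> I"
  unfolding level_def using assms by (intro Gcd_mem_diff_closed) auto

lemma mem_fibre_level:
  assumes "g \<in> {..<r} \<rightarrow>\<^sub>E carrier G" "i < r"
  obtains k where "g i \<in> fibre (int (level r g) * k)"
proof -
  have "level r g dvd expo (g i)" using assms(2) dvd_level_iff[of "level r g" r g] by simp
  then obtain k where "expo (g i) = level r g * k" by auto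
  moreover have "g i \<in> fibre (int (expo (g i)))" using assms by (intro expo) auto
  ultimately show ?thesis using that[of "int k"] by simp
qed

text \<open>For \<open>a\<close> in \<open>A\<close>, the exponents \<open>j\<close> such that
  \<open>t [^] j\<close> commutes with \<open>a\<close> form an additive group. If it contains
  \<open>\<omega>\<close> and the exponents of all entries, it contains their gcd; conversely, it
  contains all multiples of the level once it contains the level.\<close>

lemma centralizer_tuple:
  assumes g: "g \<in> {..<r} \<rightarrow>\<^sub>E carrier G"
  shows "A \<inter> centralizer G (g ` {..<r}) = fixed (int (level r g))"
proof (intro equalityI subsetI)
  fix a assume a: "a \<in> A \<inter> centralizer G (g ` {..<r})"
  have Z: "subgroup (centralizer G {a}) G" using a by (intro subgroup_centralizer) auto
  have "int (level r g) \<in> {j :: int. t [^] j \<in> centralizer G {a}}"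
  proof (rule level_mem_diff_closed)
    show "int \<omega> \<in> {j :: int. t [^] j \<in> centralizer G {a}}"
      using pow_\<omega> subgroup.one_closed[OF Z] by simp
  next
    fix i j assume "i \<in> {j :: int. t [^] j \<in> centralizer G {a}}" "j \<in> {j :: int. t [^] j \<in> centralizer G {a}}"
    then show "i - j \<in> {j :: int. t [^] j \<in> centralizer G {a}}"
      using subgroup.m_closed[OF Z] subgroup.m_inv_closed[OF Z]
      by (simp add: int_pow_diff)
  next
    fix i assume i: "i < r"
    have "a \<in> A \<inter> centralizer G {g i}" using a i by (auto simp: centralizer_def)
    also have "\<dots> = fixed (int (expo (g i)))"
      using g i by (intro centralizer_fibre expo) auto
    finally show "int (expo (g i)) \<in> {j :: int. t [^] j \<in> centralizer G {a}}"
      by (auto simp: fixed_def centralizer_def)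
  qed
  then show "a \<in> fixed (int (level r g))"
    using a by (auto simp: fixed_def centralizer_def)
next
  fix a assume a: "a \<in> fixed (int (level r g))"
  then have aA: "a \<in> A" by (simp add: fixed_def)
  have "a \<otimes> g i = g i \<otimes> a" if i: "i < r" for i
  proof -
    obtain k where k: "g i \<in> fibre (int (level r g) * k)" using g i by (rule mem_fibre_level)
    have Z: "subgroup (centralizer G {a}) G" using aA by (intro subgroup_centralizer) auto
    have "t [^] int (level r g) \<in> centralizer G {a}"
      using a by (auto simp: fixed_def centralizer_def)
    then have "(t [^] int (level r g)) [^] k \<in> centralizer G {a}"
      by (rule subgroup_int_pow_closed[OF Z])
    then have "a \<in> fixed (int (level r g) * k)"
      using aA by (auto simp: fixed_def centralizer_def int_pow_pow)
    also have "\<dots> = A \<inter> centralizer G {g i}" using k by (rule centralizer_fibre[symmetric])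
    finally show ?thesis by (simp add: centralizer_def)
  qed
  then show "a \<in> A \<inter> centralizer G (g ` {..<r})" using aA by (auto simp: centralizer_def)
qed

text \<open>The exponents over which some element centralizes the tuple are closed under
  differences. They include \<open>\<omega>\<close>, through \<open>\<one>\<close>, and each
  \<open>expo (g i)\<close>, through the entry \<open>g i\<close> itself; hence also the
  level.\<close>

lemma ex_central_generator:
  assumes g: "g \<in> commuting_tuples G r"
  shows "\<exists>h \<in> fibre (int (level r g)). h \<in> centralizer G (g ` {..<r})"
proof -
  let ?Z = "centralizer G (g ` {..<r})"
  have gc: "g i \<in> carrier G" if "i < r" for i
    using g that by (auto simp: commuting_tuples_def)
  have Z: "subgroup ?Z G" using gc by (intro subgroup_centralizer) auto
  have "int (level r g) \<in> {j. \<exists>h\<in>fibre j. h \<in> ?Z}"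
  proof (rule level_mem_diff_closed)
    have "\<one> \<in> fibre (int \<omega>)" using pow_mem_fibre[of "int \<omega>"] pow_\<omega> by simp
    then show "int \<omega> \<in> {j. \<exists>h\<in>fibre j. h \<in> ?Z}" using subgroup.one_closed[OF Z] by auto
  next
    fix i j assume "i \<in> {j. \<exists>h\<in>fibre j. h \<in> ?Z}" "j \<in> {j. \<exists>h\<in>fibre j. h \<in> ?Z}"
    then obtain x y where "x \<in> fibre i" "x \<in> ?Z" "y \<in> fibre j" "y \<in> ?Z" by auto
    then have "x \<otimes> inv y \<in> fibre (i + - j) \<and> x \<otimes> inv y \<in> ?Z"
      by (intro conjI fibre_mult fibre_inv subgroup.m_closed[OF Z] subgroup.m_inv_closed[OF Z])
    then show "i - j \<in> {j. \<exists>h\<in>fibre j. h \<in> ?Z}" by auto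
  next
    fix i assume "i < r"
    then show "int (expo (g i)) \<in> {j. \<exists>h\<in>fibre j. h \<in> ?Z}"
      using g gc expo(2)[OF gc] by (auto simp: commuting_tuples_def centralizer_def)
  qed
  then show ?thesis by simp
qed

text \<open>In the commuting case \<open>ex_central_generator\<close> supplies one element, and
  \<open>card_fibre_centralizer\<close> with \<open>centralizer_tuple\<close> counts the rest.
  Conversely, the entries lie over multiples of the level, so by
  \<open>commute_over_generator\<close> a single centralizing \<open>h\<close> would make them
  commute.\<close>

lemma card_central_generators:
  assumes g: "g \<in> {..<r} \<rightarrow>\<^sub>E carrier G"
  shows "card (fibre (int (level r g)) \<inter> centralizer G (g ` {..<r}))
    = (if g \<in> commuting_tuples G r then card (fixed (int (level r g))) else 0)"
proof (cases "g \<in> commuting_tuples G r")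
  case True
  then obtain h where "h \<in> fibre (int (level r g))" "h \<in> centralizer G (g ` {..<r})"
    using ex_central_generator by blast
  moreover have "g ` {..<r} \<subseteq> carrier G" using g by auto
  ultimately show ?thesis
    using True card_fibre_centralizer centralizer_tuple[OF g] by metis
next
  case False
  have "h \<notin> centralizer G (g ` {..<r})" if h: "h \<in> fibre (int (level r g))" for h
  proof
    assume Z: "h \<in> centralizer G (g ` {..<r})"
    have "g i \<otimes> g j = g j \<otimes> g i" if ij: "i < r" "j < r" for i j
    proof -
      obtain k where k: "g i \<in> fibre (int (level r g) * k)" using g ij(1) by (rule mem_fibre_level)
      obtain l where l: "g j \<in> fibre (int (level r g) * l)" using g ij(2) by (rule mem_fibre_level)
      have "g i \<in> centralizer G {h}" "g j \<in> centralizer G {h}"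
        using Z g ij by (auto simp: centralizer_def)
      then show ?thesis using commute_over_generator[OF h] k l by blast
    qed
    then show False using False g by (auto simp: commuting_tuples_def)
  qed
  then show ?thesis using False by (auto simp: card_eq_0_iff)
qed

section \<open>Counting commuting tuples level by level\<close>

text \<open>The elements counted lie over the \<open>\<omega> div (e * d)\<close> multiples of
  \<open>e * d\<close> below \<open>\<omega>\<close>. Over each multiple a power of \<open>h\<close>
  centralizes \<open>h\<close>, so every such fibre contributes equally many.\<close>

lemma card_centralizer_multiples:
  assumes h: "h \<in> fibre (int e)" and ed: "e * d dvd \<omega>"
  shows "card {x \<in> centralizer G {h}. e * d dvd expo x} = card (fixed (int e)) * (\<omega> div (e * d))"
proof -
  let ?Z = "centralizer G {h}"
  have hc: "h \<in> carrier G" using h by (rule fibre_closed)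
  have Z: "subgroup ?Z G" using hc by (intro subgroup_centralizer) auto
  define q where "q = \<omega> div (e * d)"
  have \<omega>: "\<omega> = e * d * q" using ed by (simp add: q_def)
  have pos: "e * d > 0" using ed \<omega>_pos by (metis dvd_0_left_iff gr0I less_numeral_extra(3))
  have "{x \<in> ?Z. e * d dvd expo x} = (\<Union>j<q. fibre (int (e * d * j)) \<inter> ?Z)"
  proof (intro equalityI subsetI)
    fix x assume x: "x \<in> {x \<in> ?Z. e * d dvd expo x}"
    then obtain j where j: "expo x = e * d * j" by auto
    have xc: "x \<in> carrier G" using x by (simp add: centralizer_def)
    have "e * d * j < e * d * q" using expo(1)[OF xc] j \<omega> by simp
    then have "j < q" using pos by simp
    then show "x \<in> (\<Union>j<q. fibre (int (e * d * j)) \<inter> ?Z)" using expo(2)[OF xc] j x by auto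
  next
    fix x assume "x \<in> (\<Union>j<q. fibre (int (e * d * j)) \<inter> ?Z)"
    then obtain j where "x \<in> fibre (int (e * d * j))" "x \<in> ?Z" by auto
    then show "x \<in> {x \<in> ?Z. e * d dvd expo x}" using dvd_expo_iff[OF ed, of x] by auto
  qed
  also have "card \<dots> = (\<Sum>j<q. card (fibre (int (e * d * j)) \<inter> ?Z))"
  proof (intro card_UN_disjoint ballI impI)
    fix j show "finite (fibre (int (e * d * j)) \<inter> ?Z)" using finite_fibre by simp
  next
    fix i j assume ij: "i \<in> {..<q}" "j \<in> {..<q}" "i \<noteq> j"
    have "e * d * i < \<omega>" "e * d * j < \<omega>" "e * d * i \<noteq> e * d * j"
      using ij pos by (auto simp: \<omega>)
    from fibre_disjoint[OF this]
    show "fibre (int (e * d * i)) \<inter> ?Z \<inter> (fibre (int (e * d * j)) \<inter> ?Z) = {}" by blast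
  qed simp
  also have "\<dots> = (\<Sum>j<q. card (fixed (int e)))"
  proof (intro sum.cong refl)
    fix j
    have "h [^] (int (d * j)) \<in> fibre (int e * int (d * j))" using h by (rule fibre_int_pow)
    moreover have "h [^] (int (d * j)) \<in> ?Z"
      using hc by (intro subgroup_int_pow_closed[OF Z]) (auto simp: centralizer_def)
    ultimately show "card (fibre (int (e * d * j)) \<inter> ?Z) = card (fixed (int e))"
      using card_fibre_centralizer[of "{h}" _ "int (e * d * j)"] hc centralizer_fibre[OF h]
      by (simp add: mult.assoc)
  qed
  finally show ?thesis by (simp add: q_def)
qed

text \<open>The level is a multiple of \<open>e * d\<close> exactly when every exponent is, so the
  tuples of such levels form a full power of the set in \<open>card_centralizer_multiples\<close>.
  The arithmetic Moebius function then extracts the exact level \<open>e\<close>.\<close>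

lemma card_tuples_centralizer_level:
  assumes h: "h \<in> fibre (int e)" and e: "e dvd \<omega>"
  shows "int (card {g \<in> {..<r} \<rightarrow>\<^sub>E centralizer G {h}. level r g = e})
    = (\<Sum>d | d dvd \<omega> div e. moebius d * int (card (fixed (int e)) * (\<omega> div (e * d))) ^ r)"
proof -
  let ?Z = "centralizer G {h}" and ?D = "{d. d dvd \<omega> div e}"
  define W where "W = ({..<r} \<rightarrow>\<^sub>E ?Z)"
  define Y where "Y = {g \<in> W. e dvd level r g}"
  have pos: "e > 0" "\<omega> div e > 0"
    using dvd_pos_nat[OF \<omega>_pos e] dvd_imp_le[OF e \<omega>_pos] by (auto simp: div_greater_zero_iff)
  have "?Z \<subseteq> carrier G" by (auto simp: centralizer_def)
  then have finZ: "finite ?Z" using finite_carrier by (rule finite_subset)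
  then have finY: "finite Y" by (simp add: Y_def W_def finite_PiE)
  have finD: "finite ?D" using pos by simp
  \<comment> \<open>With \<open>level r g = e * k\<close>, the \<open>d\<close> that count are the
    divisors of \<open>k\<close>, and their Moebius sum detects \<open>k = 1\<close>.\<close>
  have ind: "(\<Sum>d\<in>?D. if e * d dvd level r g then moebius d else 0)
      = (if level r g = e then 1 else 0)" if g: "g \<in> Y" for g
  proof -
    obtain k where k: "level r g = e * k" using g by (auto simp: Y_def)
    have "level r g > 0" using level_dvd[of r g] \<omega>_pos by (rule dvd_pos_nat[rotated])
    then have kpos: "k > 0" using k by auto
    have "k dvd \<omega> div e" using level_dvd[of r g] k e pos by (simp add: dvd_div_iff_mult mult.commute)
    then have "(\<Sum>d\<in>?D. if e * d dvd level r g then moebius d else 0) = (\<Sum>d | d dvd k. moebius d)"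
      using finD pos by (intro sum.mono_neutral_cong_right) (auto simp: k dest: dvd_trans)
    also have "\<dots> = (if level r g = e then 1 else 0)"
      using sum_moebius_divisors[OF kpos] k pos by simp
    finally show ?thesis .
  qed
  have tuples: "{g \<in> Y. e * d dvd level r g} = {..<r} \<rightarrow>\<^sub>E {x \<in> ?Z. e * d dvd expo x}"
    if "d \<in> ?D" for d
  proof -
    have "e * d dvd \<omega>" using that e pos by (simp add: dvd_div_iff_mult mult.commute)
    moreover have "e dvd level r g" if "e * d dvd level r g" for g
      using that by (rule dvd_mult_left)
    ultimately have "g \<in> Y \<and> e * d dvd level r g
        \<longleftrightarrow> g \<in> {..<r} \<rightarrow>\<^sub>E {x \<in> ?Z. e * d dvd expo x}" for g
      using dvd_level_iff[of "e * d" r g] unfolding Y_def W_def PiE_iff by blast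
    then show ?thesis by (simp only: set_eq_iff mem_Collect_eq) simp
  qed
  have "{g \<in> W. level r g = e} = {g \<in> Y. level r g = e}"
    by (auto simp: Y_def)
  then have "int (card {g \<in> {..<r} \<rightarrow>\<^sub>E ?Z. level r g = e}) = int (card {g \<in> Y. level r g = e})"
    by (simp add: W_def)
  also have "\<dots> = (\<Sum>g\<in>Y. if level r g = e then 1 else 0)"
    using finY by (simp add: sum.inter_filter[symmetric])
  also have "\<dots> = (\<Sum>g\<in>Y. \<Sum>d\<in>?D. if e * d dvd level r g then moebius d else 0)"
    using ind by (intro sum.cong) auto
  also have "\<dots> = (\<Sum>d\<in>?D. \<Sum>g\<in>Y. if e * d dvd level r g then moebius d else 0)"
    by (rule sum.swap)
  also have "\<dots> = (\<Sum>d\<in>?D. moebius d * int (card {g \<in> Y. e * d dvd level r g}))"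
    using finY by (intro sum.cong refl) (simp add: sum.inter_filter[symmetric])
  also have "\<dots> = (\<Sum>d\<in>?D. moebius d * int (card (fixed (int e)) * (\<omega> div (e * d))) ^ r)"
  proof (rule sum.cong[OF refl])
    fix d assume d: "d \<in> ?D"
    then have "e * d dvd \<omega>" using e pos by (simp add: dvd_div_iff_mult mult.commute)
    then show "moebius d * int (card {g \<in> Y. e * d dvd level r g})
        = moebius d * int (card (fixed (int e)) * (\<omega> div (e * d))) ^ r"
      using card_centralizer_multiples[OF h] by (simp add: tuples[OF d] card_PiE)
  qed
  finally show ?thesis .
qed

text \<open>Pairs of a tuple \<open>g\<close> of level \<open>e\<close> and an element
  \<open>h\<close> over \<open>e\<close> centralizing it are counted twice. Summing over
  \<open>g\<close> first, \<open>card_central_generators\<close> gives the left side; summing over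
  \<open>h\<close> first, each of the \<open>card A\<close> choices gives the same sieve
  sum.\<close>

lemma card_commuting_tuples_level:
  assumes e: "e dvd \<omega>"
  shows "int (card (fixed (int e))) * int (card {g \<in> commuting_tuples G r. level r g = e})
    = int (card A) *
      (\<Sum>d | d dvd \<omega> div e. moebius d * int (card (fixed (int e)) * (\<omega> div (e * d))) ^ r)"
proof -
  define Q where "Q = {g \<in> {..<r} \<rightarrow>\<^sub>E carrier G. level r g = e}"
  have finQ: "finite Q"
    using finite_carrier by (simp add: Q_def finite_PiE)
  have "card (fixed (int e)) * card {g \<in> commuting_tuples G r. level r g = e}
      = (\<Sum>g\<in>Q. if g \<in> commuting_tuples G r then card (fixed (int e)) else 0)"
  proof -
    have "{g \<in> commuting_tuples G r. level r g = e} = {g \<in> Q. g \<in> commuting_tuples G r}"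
      by (auto simp: Q_def commuting_tuples_def)
    then show ?thesis using finQ by (simp add: sum.inter_filter[symmetric])
  qed
  also have "\<dots> = (\<Sum>g\<in>Q. card (fibre (int e) \<inter> centralizer G (g ` {..<r})))"
    using card_central_generators by (intro sum.cong refl) (auto simp: Q_def)
  also have "\<dots> = (\<Sum>g\<in>Q. \<Sum>h\<in>fibre (int e). if h \<in> centralizer G (g ` {..<r}) then 1 else 0)"
    using finite_fibre
    by (intro sum.cong refl) (simp add: sum.inter_filter[symmetric] Collect_conj_eq)
  also have "\<dots> = (\<Sum>h\<in>fibre (int e). \<Sum>g\<in>Q. if h \<in> centralizer G (g ` {..<r}) then 1 else 0)"
    by (rule sum.swap)
  also have "\<dots> = (\<Sum>h\<in>fibre (int e). card {g \<in> {..<r} \<rightarrow>\<^sub>E centralizer G {h}. level r g = e})"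
  proof (rule sum.cong[OF refl])
    fix h assume h: "h \<in> fibre (int e)"
    have "{g \<in> Q. h \<in> centralizer G (g ` {..<r})}
        = {g \<in> {..<r} \<rightarrow>\<^sub>E centralizer G {h}. level r g = e}"
      using fibre_closed[OF h] by (auto simp: Q_def centralizer_def PiE_iff)
    then show "(\<Sum>g\<in>Q. if h \<in> centralizer G (g ` {..<r}) then 1 else 0)
        = card {g \<in> {..<r} \<rightarrow>\<^sub>E centralizer G {h}. level r g = e}"
      using finQ by (simp add: sum.inter_filter[symmetric])
  qed
  finally have "int (card (fixed (int e)) * card {g \<in> commuting_tuples G r. level r g = e})
      = (\<Sum>h\<in>fibre (int e). int (card {g \<in> {..<r} \<rightarrow>\<^sub>E centralizer G {h}. level r g = e}))"
    by simp
  then show ?thesis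
    using card_tuples_centralizer_level[OF _ e] card_fibre by simp
qed

text \<open>The tuples are sorted by level \<open>e = \<omega> div n\<close>, where \<open>n\<close>
  is the order of \<open>t [^] e\<close>. The ratio of \<open>card A\<close> to
  \<open>card (fixed (int e))\<close> left over from the double count is
  \<open>idx n\<close>.\<close>

lemma commuting_prob_eq:
  assumes idx: "\<And>n. n dvd \<omega> \<Longrightarrow> idx n * card (fixed (int (\<omega> div n))) = card A"
  shows "commuting_prob G r
    = (\<Sum>n | n dvd \<omega>. \<Sum>d | d dvd n.
        real_of_int (moebius d) * real (idx n) / real (idx n * (\<omega> * d div n)) ^ r)"
proof -
  let ?T = "commuting_tuples G r"
  have "card ?T = (\<Sum>e | e dvd \<omega>. card {g \<in> ?T. level r g = e})"
  proof -
    have "finite ?T"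
      using finite_carrier by (intro finite_subset[OF _ finite_PiE[of "{..<r}" "\<lambda>_. carrier G"]])
        (auto simp: commuting_tuples_def)
    moreover have "level r ` ?T \<subseteq> {e. e dvd \<omega>}" using level_dvd by auto
    ultimately show ?thesis
      using sum.group[of ?T "{e. e dvd \<omega>}" "level r" "\<lambda>_. 1 :: nat"] \<omega>_pos by simp
  qed
  also have "\<dots> = (\<Sum>n | n dvd \<omega>. card {g \<in> ?T. level r g = \<omega> div n})"
    using \<omega>_pos
    by (intro sum.reindex_bij_witness[of _ "\<lambda>n. \<omega> div n" "\<lambda>n. \<omega> div n"])
       (auto simp: div_div_eq_right)
  finally have "commuting_prob G r
      = (\<Sum>n | n dvd \<omega>. real (card {g \<in> ?T. level r g = \<omega> div n}) / real (Coset.order G) ^ r)"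
    by (simp add: commuting_prob_def sum_divide_distrib)
  also have "\<dots> = (\<Sum>n | n dvd \<omega>. \<Sum>d | d dvd n.
        real_of_int (moebius d) * real (idx n) / real (idx n * (\<omega> * d div n)) ^ r)"
  proof (rule sum.cong[OF refl])
    fix n assume "n \<in> {n. n dvd \<omega>}"
    then obtain e where \<omega>: "\<omega> = n * e" by auto
    then have npos: "n > 0" "e > 0" using \<omega>_pos by auto
    have e: "\<omega> div n = e" "\<omega> div e = n" "e dvd \<omega>" using npos \<omega> by auto
    let ?c = "card (fixed (int e))" and ?N = "card {g \<in> ?T. level r g = e}"
    have c: "?c > 0" by (rule card_fixed_pos)
    have A: "card A = idx n * ?c" using idx[of n] e \<omega> by simp
    have ipos: "idx n > 0"
      using A finite_A subgroup.one_closed[OF subgroup_A] by (metis card_0_eq empty_iff gr0I mult_0)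
    have "int ?c * int ?N = int ?c * (int (idx n) *
        (\<Sum>d | d dvd n. moebius d * int (?c * (\<omega> div (e * d))) ^ r))"
      using card_commuting_tuples_level[OF e(3), of r] by (simp add: A e mult_ac)
    then have "int ?N = int (idx n) * (\<Sum>d | d dvd n. moebius d * int (?c * (\<omega> div (e * d))) ^ r)"
      using c by simp
    then have "real ?N = real (idx n) *
        (\<Sum>d | d dvd n. real_of_int (moebius d) * real (?c * (\<omega> div (e * d))) ^ r)"
      using arg_cong[where f = real_of_int] by fastforce
    then have "real ?N / real (Coset.order G) ^ r = (\<Sum>d | d dvd n.
        real_of_int (moebius d) * real (idx n) * (real (?c * (\<omega> div (e * d))) / real (Coset.order G)) ^ r)"
      by (simp add: sum_distrib_left sum_divide_distrib power_divide mult_ac)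
    also have "\<dots> = (\<Sum>d | d dvd n.
        real_of_int (moebius d) * real (idx n) / real (idx n * (\<omega> * d div n)) ^ r)"
    proof (rule sum.cong[OF refl])
      fix d assume "d \<in> {d. d dvd n}"
      then obtain q where q: "n = d * q" by auto
      then have dq: "d > 0" "q > 0" using npos by auto
      have "\<omega> div (e * d) = q" "\<omega> * d div n = e * d"
        using dq npos by (auto simp: \<omega> q mult_ac)
      \<comment> \<open>The order of \<open>G\<close> is \<open>idx n * ?c * \<omega>\<close> with
        \<open>\<omega> = d * q * e\<close>, so \<open>?c * q\<close> cancels.\<close>
      moreover have "real (?c * q) / real (Coset.order G) = 1 / real (idx n * (e * d))"
        using c ipos dq npos by (simp add: order_eq A \<omega> q field_simps)
      ultimately show "real_of_int (moebius d) * real (idx n)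
            * (real (?c * (\<omega> div (e * d))) / real (Coset.order G)) ^ r
          = real_of_int (moebius d) * real (idx n) / real (idx n * (\<omega> * d div n)) ^ r"
        by (simp only: power_one_over) simp
    qed
    finally show "real (card {g \<in> ?T. level r g = \<omega> div n}) / real (Coset.order G) ^ r
        = (\<Sum>d | d dvd n.
            real_of_int (moebius d) * real (idx n) / real (idx n * (\<omega> * d div n)) ^ r)"
      by (simp only: e)
  qed
  finally show ?thesis .
qed

section \<open>Fixed points of the subgroups of the complement, and their indices in
  \<open>A\<close>\<close>

text \<open>Being fixed under conjugation by \<open>b\<close> means that \<open>b\<close> lies in
  the centralizer of \<open>a\<close>; as that is a subgroup, the generator alone decides.\<close>

lemma fixed_points_generate: "fixed_points G A (generate G {t [^] (j :: nat)}) = fixed (int j)"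
proof -
  have "(\<forall>b\<in>generate G {t [^] j}. b \<otimes> a \<otimes> inv b = a) \<longleftrightarrow> a \<in> centralizer G {t [^] int j}"
    if a: "a \<in> A" for a
  proof -
    have Z: "subgroup (centralizer G {a}) G" using a by (intro subgroup_centralizer) auto
    have conj: "b \<otimes> a \<otimes> inv b = a \<longleftrightarrow> b \<in> centralizer G {a}" if "b \<in> carrier G" for b
      using that a inv_solve_right'[of a "b \<otimes> a" b] by (auto simp: centralizer_def)
    have gen: "generate G {t [^] j} \<subseteq> carrier G" by (intro generate_incl) auto
    have "(\<forall>b\<in>generate G {t [^] j}. b \<otimes> a \<otimes> inv b = a)
        \<longleftrightarrow> generate G {t [^] j} \<subseteq> centralizer G {a}"
      using conj gen by blast
    also have "\<dots> \<longleftrightarrow> t [^] j \<in> centralizer G {a}"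
      using generate_subgroup_incl[OF _ Z, of "{t [^] j}"] generate.incl[of "t [^] j" "{t [^] j}" G]
      by auto
    also have "\<dots> \<longleftrightarrow> a \<in> centralizer G {t [^] int j}"
      using a by (auto simp: centralizer_def int_pow_int)
    finally show ?thesis .
  qed
  then show ?thesis by (auto simp: fixed_points_def fixed_def)
qed

lemma index_fixed_mult_card:
  "subgroup_index (G\<lparr>carrier := A\<rparr>) (fixed j) * card (fixed j) = card A"
proof -
  have "subgroup (fixed j) (G\<lparr>carrier := A\<rparr>)"
    using subgroup_fixed subgroup_A by (intro subgroup_incl) (auto simp: fixed_def)
  then show ?thesis
    using group.lagrange[OF subgroup_imp_group[OF subgroup_A]]
    by (simp add: subgroup_index_def Coset.order_def)
qed

end

section \<open>The expansion in the coefficients \<open>c_coeff\<close>, and its comparison with the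
  explicit one\<close>

text \<open>By Lagrange, dividing \<open>card H\<close> by the group order gives the inverse of the
  index; subgroups of equal index are then collected. \<open>S\<close> may be larger than the set of
  indices, so that two expansions can share one index set.\<close>

lemma (in group) commuting_prob_eq_sum_c_coeff:
  assumes "finite (carrier G)" "\<not> comm_group G"
    and "finite S" "\<And>H. H \<in> abelian_subgroups G \<Longrightarrow> subgroup_index G H \<in> S"
  shows "commuting_prob G r = (\<Sum>m\<in>S. real_of_int (c_coeff G m) / real m ^ r)"
proof -
  let ?U = "abelian_subgroups G"
  have "?U \<subseteq> Pow (carrier G)"
    using subgroup.subset by (auto simp: abelian_subgroups_def)
  then have finU: "finite ?U" using assms(1) by (simp add: finite_subset)
  have og: "Coset.order G > 0" using assms(1) order_gt_0_iff_finite by blast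
  have quot: "real (card H) / real (Coset.order G) = 1 / real (subgroup_index G H)" if "H \<in> ?U" for H
  proof -
    have lag: "subgroup_index G H * card H = Coset.order G"
      using that lagrange by (simp add: abelian_subgroups_def subgroup_index_def)
    then have "subgroup_index G H > 0" "card H > 0" using og by (auto intro: gr0I)
    then show ?thesis by (simp add: lag[symmetric] field_simps)
  qed
  have "real (card (commuting_tuples G r))
      = - (\<Sum>H\<in>?U. real_of_int (mu2 G H (carrier G)) * real (card H) ^ r)"
    using arg_cong[where f = real_of_int, OF card_commuting_tuples_eq_sum_mu2[OF assms(1,2), of r]]
    by simp
  then have "commuting_prob G r
      = (\<Sum>H\<in>?U. - real_of_int (mu2 G H (carrier G)) * (real (card H) / real (Coset.order G)) ^ r)"
    by (simp add: commuting_prob_def sum_divide_distrib sum_negf power_divide)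
  also have "\<dots> = (\<Sum>H\<in>?U. - real_of_int (mu2 G H (carrier G)) / real (subgroup_index G H) ^ r)"
    using quot by (intro sum.cong refl) (simp add: power_one_over)
  also have "\<dots> = (\<Sum>m\<in>S. \<Sum>H\<in>{H \<in> ?U. subgroup_index G H = m}.
      - real_of_int (mu2 G H (carrier G)) / real (subgroup_index G H) ^ r)"
    using assms(3,4) finU by (intro sum.group[symmetric]) auto
  also have "\<dots> = (\<Sum>m\<in>S. real_of_int (c_coeff G m) / real m ^ r)"
    by (intro sum.cong refl) (simp add: c_coeff_def sum_divide_distrib sum_negf)
  finally show ?thesis .
qed

theorem corollary4p20:
  fixes G :: "('a, 'b) monoid_scheme" (structure)
    and A :: "'a set" and t :: 'a and \<omega> :: nat
    and B C :: "nat \<Rightarrow> 'a set" and idx :: "nat \<Rightarrow> nat" and M :: "nat \<Rightarrow> nat \<Rightarrow> nat"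
  assumes "group G" and "\<not> comm_group G"
    and "t \<in> carrier G" and "semidirect_product G A (generate G {t})"
    and "finite A" and "comm_group (G\<lparr>carrier := A\<rparr>)"
    and "group.ord G t = \<omega>" and "\<omega> > 0"
    and "\<And>n. n dvd \<omega> \<Longrightarrow> B n = generate G {t [^] (\<omega> div n)}"
    and "\<And>n. n dvd \<omega> \<Longrightarrow> C n = fixed_points G A (B n)"
    and "\<And>n. n dvd \<omega> \<Longrightarrow> idx n = subgroup_index (G\<lparr>carrier := A\<rparr>) (C n)"
    and "\<And>n d. n dvd \<omega> \<Longrightarrow> d dvd n \<Longrightarrow> M n d = idx n * (\<omega> * d div n)"
  shows "(\<forall>m\<ge>2. c_coeff G m =
            (\<Sum>(n, d)\<in>{(n, d). n dvd \<omega> \<and> d dvd n \<and> m = M n d}. moebius d * int (idx n)))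
       \<and> commuting_gf G =
            (\<Sum>n\<in>{n. n dvd \<omega>}. \<Sum>d\<in>{d. d dvd n}.
               fps_const (of_int (moebius d) * of_nat (idx n)) /
               (of_nat (M n d) * (of_nat (M n d) - fps_X)))"
proof -
  interpret group G by fact
  interpret abelian_by_cyclic G A t \<omega>
    using assms(3-8) by (intro abelian_by_cyclic.intro abelian_by_cyclic_axioms.intro group_axioms)
  have idx: "idx n * card (fixed (int (\<omega> div n))) = card A" if "n dvd \<omega>" for n
    using assms(9-11)[OF that] fixed_points_generate index_fixed_mult_card by simp
  have A_pos: "card A > 0"
    using finite_A subgroup.one_closed[OF subgroup_A] by (auto simp: card_gt_0_iff)
  have M_pos: "M n d > 0" if nd: "n dvd \<omega>" "d dvd n" for n d
  proof -
    obtain k where k: "\<omega> = n * k" using nd(1) by auto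
    have "idx n > 0" using idx[OF nd(1)] A_pos by (auto intro: gr0I)
    moreover have "d > 0" using nd \<omega>_pos by (meson dvd_pos_nat)
    ultimately show ?thesis using assms(12)[OF nd] \<omega>_pos by (auto simp: k mult_ac)
  qed
  define J where "J = (SIGMA n:{n. n dvd \<omega>}. {d. d dvd n})"
  have fin_dvd: "finite {n. n dvd \<omega>}" "\<And>n. n dvd \<omega> \<Longrightarrow> finite {d. d dvd n}"
    using \<omega>_pos by (auto intro: finite_divisors_nat dvd_pos_nat)
  then have finJ: "finite J" unfolding J_def by auto
  have prob: "commuting_prob G r = (\<Sum>n | n dvd \<omega>. \<Sum>d | d dvd n.
      real_of_int (moebius d) * real (idx n) / real (M n d) ^ r)" for r
    using commuting_prob_eq[OF idx, of r] assms(12) by simp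
  define c where "c m =
    (\<Sum>(n, d)\<in>{(n, d). n dvd \<omega> \<and> d dvd n \<and> m = M n d}. moebius d * int (idx n))" for m
  have "c_coeff G m = c m" if "m \<ge> 2" for m
  proof -
    \<comment> \<open>A common index set for both expansions. It also contains \<open>m\<close>, so
      that coefficient can be compared even if \<open>m\<close> occurs in neither of them.\<close>
    define S where "S = insert m (subgroup_index G ` abelian_subgroups G \<union> (\<lambda>(n, d). M n d) ` J)"
    have "abelian_subgroups G \<subseteq> Pow (carrier G)"
      using subgroup.subset by (auto simp: abelian_subgroups_def)
    then have finS: "finite S"
      using finite_carrier finJ by (simp add: S_def finite_subset)
    have index_pos: "subgroup_index G H > 0" if "H \<in> abelian_subgroups G" for H
    proof -
      have "subgroup_index G H * card H = Coset.order G"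
        using that lagrange by (simp add: abelian_subgroups_def subgroup_index_def)
      then show ?thesis using order_eq A_pos \<omega>_pos by (auto intro: gr0I)
    qed
    have S0: "0 \<notin> S"
      using that by (auto simp: S_def J_def dest!: index_pos M_pos)
    have "commuting_prob G r = (\<Sum>m\<in>S. real_of_int (c m) / real m ^ r)" for r
    proof -
      have "commuting_prob G r
          = (\<Sum>(n, d)\<in>J. real_of_int (moebius d) * real (idx n) / real (M n d) ^ r)"
        unfolding prob J_def using fin_dvd by (simp add: sum.Sigma)
      \<comment> \<open>Different pairs can give the same \<open>M n d\<close>; collecting them by
        this value produces \<open>c\<close>.\<close>
      also have "\<dots> = (\<Sum>m\<in>S. \<Sum>(n, d)\<in>{p \<in> J. (case p of (n, d) \<Rightarrow> M n d) = m}.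
          real_of_int (moebius d) * real (idx n) / real (M n d) ^ r)"
        using finS finJ by (intro sum.group[symmetric]) (auto simp: S_def)
      also have "\<dots> = (\<Sum>m\<in>S. real_of_int (c m) / real m ^ r)"
      proof (rule sum.cong[OF refl])
        fix m
        have "{p \<in> J. (case p of (n, d) \<Rightarrow> M n d) = m} = {(n, d). n dvd \<omega> \<and> d dvd n \<and> m = M n d}"
          by (auto simp: J_def)
        then show "(\<Sum>(n, d)\<in>{p \<in> J. (case p of (n, d) \<Rightarrow> M n d) = m}.
            real_of_int (moebius d) * real (idx n) / real (M n d) ^ r) = real_of_int (c m) / real m ^ r"
          by (auto simp: c_def sum_divide_distrib intro!: sum.cong)
      qed
      finally show ?thesis .
    qed
    moreover have "commuting_prob G r = (\<Sum>m\<in>S. real_of_int (c_coeff G m) / real m ^ r)" for r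
      using finite_carrier assms(2) finS
      by (rule commuting_prob_eq_sum_c_coeff) (simp add: S_def)
    ultimately have "real_of_int (c_coeff G m) = real_of_int (c m)"
      using finS S0
      by (intro inverse_power_sums_unique[of S m "\<lambda>m. real_of_int (c_coeff G m)"
            "\<lambda>m. real_of_int (c m)"]) (auto simp only: S_def insertI1)
    then show ?thesis by simp
  qed
  moreover have "commuting_gf G = (\<Sum>n\<in>{n. n dvd \<omega>}. \<Sum>d\<in>{d. d dvd n}.
      fps_const (of_int (moebius d) * of_nat (idx n)) /
        (of_nat (M n d) * (of_nat (M n d) - fps_X)))"
  proof (rule fps_ext)
    fix k
    show "fps_nth (commuting_gf G) k = fps_nth (\<Sum>n\<in>{n. n dvd \<omega>}. \<Sum>d\<in>{d. d dvd n}.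
        fps_const (of_int (moebius d) * of_nat (idx n)) /
          (of_nat (M n d) * (of_nat (M n d) - fps_X))) k"
      \<comment> \<open>Rewriting numerals of the power series ring as constant series brings each
        summand into the form of \<open>fps_const_divide_linear_nth\<close>.\<close>
      unfolding fps_of_nat[symmetric] fps_sum_nth
      by (auto simp: commuting_gf_def prob M_pos fps_const_divide_linear_nth intro!: sum.cong)
  qed
  ultimately show ?thesis by (simp add: c_def)
qed

end
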